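(* Let $m\ge2$, let $C=(c_{jk})$ be an $m\times m$ cost matrix, and let $\overline C=C_M1_m^{T}-C$, with columns $\overline C_1,\ldots,\overline C_m$, where $C_M=(c_{1M},\ldots,c_{mM})^{T}$, $c_{jM}=\max_kc_{jk}$. For a proper scoring rule $L(j,q)$, define $$\underline\psi^C(t)=\inf_{\substack{\eta',q'\in\Delta_m:\ \|\overline C^{T}(\eta'-q')\|_{\infty2}=t,\\ \max_{j}(\overline C_j^{T}q')\le 1_m^{T}\overline C^{T}q'/2}}B_L(\eta',q'),\qquad t\ge0.$$ Then the regrets of $L^{\mathrm{cw}}(j,\overline C^{T}q)$ and $L(j,q)$ satisfy, for all $\eta,q\in\Delta_m$, $$\underline\psi^C\left(B^{\mathrm{cw}}(\eta,\overline C^{T}q)\right)\le B_L(\eta,q).$$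
   Context: $\Delta_m=\{q\in\mathbb R^m: q_j\ge0,\ \sum_jq_j=1\}$; $1_m$ is the all-ones vector; $\|b\|_{\infty2}=\max_{j\ne k}(|b_j|+|b_k|)$. A cost matrix $C=(C_1,\ldots,C_m)$ (columns $C_k$) has $c_{jk}\ge0$, $c_{jj}=0$, and for each $j$, $c_{jk}>0$ for some $k\ne j$. A scoring rule is a loss $L(j,q)$, $j\in\{1,\dots,m\}$, with action space $\Delta_m$ and values in $(-\infty,\infty]$ (with $0\cdot\infty=0$), whose generalized entropy $H_L(\eta)=\inf_{q\in\Delta_m}\sum_j\eta_jL(j,q)$ is finite; it is proper if $H_L(\eta)=\sum_j\eta_jL(j,\eta)$ for all $\eta\in\Delta_m$. The regret is $B_L(\eta,q)=\sum_j\eta_jL(j,q)-H_L(\eta)$. The cost-weighted classification loss is $L^{\mathrm{cw}}(j,\gamma)=c_{jk}$ if $k=\mathrm{argmax}_l\gamma_l$, $\gamma\in\mathbb R^m$ (ties broken by any fixed rule), with regret $B^{\mathrm{cw}}(\eta,\gamma)=\sum_j\eta_jL^{\mathrm{cw}}(j,\gamma)-\min_k\eta^{T}C_k$. The infimum over an empty set is $+\infty$. *)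

theory Defs
  imports "HOL-Analysis.Analysis"
begin

text \<open>
  Categories are the elements of a finite type \<open>'m\<close>, so that \<open>m = CARD('m)\<close>.
  For a matrix \<open>C\<close>, the entry with row \<open>j\<close> and column \<open>k\<close> is \<open>C $ j $ k\<close>.
\<close>

definition prob_simplex :: "(real ^ 'm) set" where
  "prob_simplex = {q. (\<forall>j. 0 \<le> q $ j) \<and> (\<Sum>j\<in>UNIV. q $ j) = 1}"

text \<open>The maximum ranges over a nonempty set only if \<open>CARD('m) \<ge> 2\<close>.\<close>

definition norm_inf2 :: "real ^ 'm \<Rightarrow> real" where
  "norm_inf2 b = Max {\<bar>b $ j\<bar> + \<bar>b $ k\<bar> | j k. j \<noteq> k}"

definition cost_matrix :: "real ^ 'm ^ 'm \<Rightarrow> bool" where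
  "cost_matrix C \<longleftrightarrow>
     (\<forall>j k. 0 \<le> C $ j $ k) \<and> (\<forall>j. C $ j $ j = 0) \<and> (\<forall>j. \<exists>k. k \<noteq> j \<and> 0 < C $ j $ k)"

definition row_max :: "real ^ 'm ^ 'm \<Rightarrow> real ^ 'm" where
  "row_max C = (\<chi> j. Max (range (\<lambda>k. C $ j $ k)))"

definition cost_bar :: "real ^ 'm ^ 'm \<Rightarrow> real ^ 'm ^ 'm" where
  "cost_bar C = (\<chi> j k. row_max C $ j - C $ j $ k)"

text \<open>
  Multiplication on \<^typ>\<open>ereal\<close> satisfies \<open>0 * \<infinity> = 0\<close>. Losses are only
  constrained on the simplex, where they never take the value \<open>-\<infinity>\<close>.
\<close>

definition risk :: "('m \<Rightarrow> real ^ 'm \<Rightarrow> ereal) \<Rightarrow> real ^ 'm \<Rightarrow> real ^ 'm \<Rightarrow> ereal" where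
  "risk L \<eta> q = (\<Sum>j\<in>UNIV. ereal (\<eta> $ j) * L j q)"

definition gen_entropy :: "('m \<Rightarrow> real ^ 'm \<Rightarrow> ereal) \<Rightarrow> real ^ 'm \<Rightarrow> ereal" where
  "gen_entropy L \<eta> = (INF q\<in>prob_simplex. risk L \<eta> q)"

definition scoring_rule :: "('m \<Rightarrow> real ^ 'm \<Rightarrow> ereal) \<Rightarrow> bool" where
  "scoring_rule L \<longleftrightarrow>
     (\<forall>j. \<forall>q\<in>prob_simplex. L j q \<noteq> -\<infinity>) \<and>
     (\<forall>\<eta>\<in>prob_simplex. \<bar>gen_entropy L \<eta>\<bar> \<noteq> \<infinity>)"

definition proper_scoring_rule :: "('m \<Rightarrow> real ^ 'm \<Rightarrow> ereal) \<Rightarrow> bool" where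
  "proper_scoring_rule L \<longleftrightarrow>
     scoring_rule L \<and> (\<forall>\<eta>\<in>prob_simplex. gen_entropy L \<eta> = risk L \<eta> \<eta>)"

definition regret :: "('m \<Rightarrow> real ^ 'm \<Rightarrow> ereal) \<Rightarrow> real ^ 'm \<Rightarrow> real ^ 'm \<Rightarrow> ereal" where
  "regret L \<eta> q = risk L \<eta> q - gen_entropy L \<eta>"

text \<open>A fixed tie-breaking rule is a function selecting some maximizing index of each vector.\<close>

definition argmax_rule :: "(real ^ 'm \<Rightarrow> 'm) \<Rightarrow> bool" where
  "argmax_rule sel \<longleftrightarrow> (\<forall>\<gamma>. is_arg_max (\<lambda>l. \<gamma> $ l) (\<lambda>l. True) (sel \<gamma>))"

definition loss_cw :: "(real ^ 'm \<Rightarrow> 'm) \<Rightarrow> real ^ 'm ^ 'm \<Rightarrow> 'm \<Rightarrow> real ^ 'm \<Rightarrow> real" where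
  "loss_cw sel C j \<gamma> = C $ j $ sel \<gamma>"

definition regret_cw ::
  "(real ^ 'm \<Rightarrow> 'm) \<Rightarrow> real ^ 'm ^ 'm \<Rightarrow> real ^ 'm \<Rightarrow> real ^ 'm \<Rightarrow> real" where
  "regret_cw sel C \<eta> \<gamma> =
     (\<Sum>j\<in>UNIV. \<eta> $ j * loss_cw sel C j \<gamma>) - Min (range (\<lambda>k. \<eta> \<bullet> column k C))"

text \<open>The infimum is taken in \<^typ>\<open>ereal\<close>, so it is \<open>\<infinity>\<close> if no pair is feasible.\<close>

definition psi_lower ::
  "('m \<Rightarrow> real ^ 'm \<Rightarrow> ereal) \<Rightarrow> real ^ 'm ^ 'm \<Rightarrow> real \<Rightarrow> ereal" where
  "psi_lower L C t =
     (INF (\<eta>, q) \<in> {(\<eta>, q). \<eta> \<in> prob_simplex \<and> q \<in> prob_simplex \<and>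
          norm_inf2 (transpose (cost_bar C) *v (\<eta> - q)) = t \<and>
          Max (range (\<lambda>j. column j (cost_bar C) \<bullet> q))
            \<le> (vec 1 \<bullet> (transpose (cost_bar C) *v q)) / 2}.
        regret L \<eta> q)"

end

theory Submission
  imports Defs
begin

text \<open>
  Write \<open>v = C\<^sup>T q\<close> and \<open>u = C\<^sup>T \<eta>\<close> with \<open>C\<close> the matrix \<open>cost_bar\<close>. The cost-weighted regret is
  \<open>t = u\<^sub>k - u\<^sub>s\<close>, where \<open>k\<close> maximizes \<open>u\<close> and \<open>s\<close> maximizes \<open>v\<close>. Moving \<open>q\<close> towards \<open>\<eta>\<close>, stop at the
  first point \<open>q'\<close> where the \<open>s\<close>-component is at most half of the total; it is then still maximal,
  since all components are nonnegative. Hence \<open>q'\<close> is feasible and the components \<open>k\<close>, \<open>s\<close> of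
  the score difference give norm at least \<open>t\<close>; moving \<open>\<eta>\<close> towards \<open>q'\<close> makes it equal to
  \<open>t\<close>. Regrets of a proper scoring rule decrease under both moves.
\<close>

lemma prob_simplex_segment:
  assumes "x \<in> prob_simplex" "y \<in> prob_simplex" "0 \<le> a" "a \<le> 1"
  shows "(1 - a) *\<^sub>R x + a *\<^sub>R y \<in> prob_simplex"
  using assms by (simp add: prob_simplex_def sum.distrib flip: sum_distrib_left)

lemma axis_in_prob_simplex: "axis i 1 \<in> prob_simplex"
  by (simp add: prob_simplex_def axis_def)

subsection \<open>Regrets of proper scoring rules\<close>

text \<open>Distributivity can fail in \<open>ereal\<close> when infinities of opposite sign meet.
  Here all weights are finite and nonnegative, so it holds term by term even for infinite
  losses.\<close>

lemma risk_segment: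
  fixes x y :: "real ^ 'm"
  assumes x: "x \<in> prob_simplex" and y: "y \<in> prob_simplex" and a: "0 \<le> a" "a \<le> 1"
  shows "risk L ((1 - a) *\<^sub>R x + a *\<^sub>R y) q = ereal (1 - a) * risk L x q + ereal a * risk L y q"
proof -
  have scale: "ereal c * (\<Sum>j\<in>A. f j) = (\<Sum>j\<in>A. ereal c * f j)"
    if "0 \<le> c" "finite A" for c and f :: "'m \<Rightarrow> ereal" and A
    using that(2,1) by induction (simp_all add: ereal_pos_distrib)
  have "ereal (((1 - a) *\<^sub>R x + a *\<^sub>R y) $ j) * L j q
      = ereal (1 - a) * (ereal (x $ j) * L j q) + ereal a * (ereal (y $ j) * L j q)" for j
  proof -
    have "0 \<le> (1 - a) * x $ j" "0 \<le> a * y $ j"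
      using x y a by (auto simp: prob_simplex_def)
    then have "(ereal ((1 - a) * x $ j) + ereal (a * y $ j)) * L j q
        = ereal ((1 - a) * x $ j) * L j q + ereal (a * y $ j) * L j q"
      by (intro ereal_left_distrib) auto
    then show ?thesis
      by (simp add: mult.assoc[symmetric])
  qed
  then show ?thesis
    using a by (simp add: risk_def scale sum.distrib)
qed

context
  fixes L :: "'m \<Rightarrow> real ^ 'm \<Rightarrow> ereal"
  assumes proper: "proper_scoring_rule L"
begin

lemma gen_entropy_le_risk: "q \<in> prob_simplex \<Longrightarrow> gen_entropy L \<eta> \<le> risk L \<eta> q"
  by (simp add: gen_entropy_def INF_lower)

lemma gen_entropy_finite:
  assumes "\<eta> \<in> prob_simplex"
  obtains h where "gen_entropy L \<eta> = ereal h"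
  using assms proper by (cases "gen_entropy L \<eta>") (auto simp: proper_scoring_rule_def scoring_rule_def)

lemma risk_self: "\<eta> \<in> prob_simplex \<Longrightarrow> risk L \<eta> \<eta> = gen_entropy L \<eta>"
  using proper by (simp add: proper_scoring_rule_def)

lemma regret_nonneg:
  assumes "\<eta> \<in> prob_simplex" "q \<in> prob_simplex"
  shows "0 \<le> regret L \<eta> q"
  using gen_entropy_le_risk[OF assms(2), of \<eta>] gen_entropy_finite[OF assms(1)]
  by (metis abs_ereal.simps(1) ereal_diff_positive regret_def)

lemma regret_self:
  assumes "\<eta> \<in> prob_simplex"
  shows "regret L \<eta> \<eta> = 0"
  using gen_entropy_finite[OF assms] by (metis assms ereal_minus(1) diff_self regret_def risk_self zero_ereal_def)

text \<open>Along the segment from \<open>q\<close> to \<open>\<eta>\<close>, the risk of the fixed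
  action \<open>q\<close> is affine and the entropy is concave. The regret is therefore convex
  there, and by properness it vanishes at \<open>q\<close>.\<close>

lemma regret_shrink_outcome:
  assumes \<eta>: "\<eta> \<in> prob_simplex" and q: "q \<in> prob_simplex" and a: "0 \<le> a" "a \<le> 1"
  shows "regret L ((1 - a) *\<^sub>R q + a *\<^sub>R \<eta>) q \<le> regret L \<eta> q"
proof -
  let ?z = "(1 - a) *\<^sub>R q + a *\<^sub>R \<eta>"
  have z: "?z \<in> prob_simplex" by (rule prob_simplex_segment[OF q \<eta> a])
  obtain hq where hq: "gen_entropy L q = ereal hq" using gen_entropy_finite[OF q] .
  obtain h\<eta> where h\<eta>: "gen_entropy L \<eta> = ereal h\<eta>" using gen_entropy_finite[OF \<eta>] .
  obtain hz where hz: "gen_entropy L ?z = ereal hz" using gen_entropy_finite[OF z] .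
  \<comment> \<open>Concavity of the entropy: the optimal action at \<open>?z\<close> is
    \<open>?z\<close> itself, and it cannot beat the optimum at \<open>q\<close> or at
    \<open>\<eta>\<close>.\<close>
  have "ereal (1 - a) * ereal hq + ereal a * ereal h\<eta>
      \<le> ereal (1 - a) * risk L q ?z + ereal a * risk L \<eta> ?z"
    using gen_entropy_le_risk[OF z] a by (intro add_mono ereal_mult_left_mono) (auto simp flip: hq h\<eta>)
  also have "\<dots> = ereal hz"
    using risk_segment[OF q \<eta> a] risk_self[OF z] hz by simp
  finally have conc: "(1 - a) * hq + a * h\<eta> \<le> hz" by simp
  have rz: "risk L ?z q = ereal (1 - a) * ereal hq + ereal a * risk L \<eta> q"
    using risk_segment[OF q \<eta> a] risk_self[OF q] hq by simp
  show ?thesis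
  proof (cases "risk L \<eta> q")
    case (real r)
    have "h\<eta> \<le> r" using gen_entropy_le_risk[OF q, of \<eta>] real h\<eta> by simp
    then have "0 \<le> (1 - a) * (r - h\<eta>)" using a by simp
    then have "(1 - a) * hq + a * r - hz \<le> r - h\<eta>" using conc by (simp add: algebra_simps)
    then show ?thesis by (simp add: regret_def rz real hz h\<eta>)
  next
    case PInf
    then show ?thesis by (simp add: regret_def h\<eta>)
  next
    case MInf
    then show ?thesis using gen_entropy_le_risk[OF q, of \<eta>] h\<eta> by simp
  qed
qed

text \<open>Under outcome \<open>?z\<close>, action \<open>?z\<close> is at least as good as
  \<open>q\<close>. Its advantage cannot come from the \<open>q\<close> part of the mixture, where
  \<open>q\<close> is already optimal, so it comes from the \<open>\<eta>\<close> part.\<close>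

lemma regret_shrink_action:
  assumes \<eta>: "\<eta> \<in> prob_simplex" and q: "q \<in> prob_simplex" and a: "0 \<le> a" "a \<le> 1"
  shows "regret L \<eta> ((1 - a) *\<^sub>R q + a *\<^sub>R \<eta>) \<le> regret L \<eta> q"
proof (cases "a = 0")
  case False
  let ?z = "(1 - a) *\<^sub>R q + a *\<^sub>R \<eta>"
  have z: "?z \<in> prob_simplex" by (rule prob_simplex_segment[OF q \<eta> a])
  obtain hq where hq: "gen_entropy L q = ereal hq" using gen_entropy_finite[OF q] .
  obtain h\<eta> where h\<eta>: "gen_entropy L \<eta> = ereal h\<eta>" using gen_entropy_finite[OF \<eta>] .
  \<comment> \<open>\<open>risk L q ?z\<close> may be infinite; its finite lower bound
    \<open>hq\<close> can be cancelled later.\<close>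
  have "ereal (1 - a) * ereal hq + ereal a * risk L \<eta> ?z
      \<le> ereal (1 - a) * risk L q ?z + ereal a * risk L \<eta> ?z"
    using gen_entropy_le_risk[OF z] a by (intro add_mono ereal_mult_left_mono) (auto simp flip: hq)
  also have "\<dots> = risk L ?z ?z" using risk_segment[OF q \<eta> a] by simp
  also have "\<dots> \<le> risk L ?z q" using gen_entropy_le_risk[OF q] risk_self[OF z] by simp
  also have "\<dots> = ereal (1 - a) * ereal hq + ereal a * risk L \<eta> q"
    using risk_segment[OF q \<eta> a] risk_self[OF q] hq by simp
  finally have "ereal a * risk L \<eta> ?z \<le> ereal a * risk L \<eta> q"
    by (metis ereal_add_le_add_iff ereal_infty_less(1) less_irrefl times_ereal.simps(1) PInfty_neq_ereal(1) MInfty_neq_ereal(1))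
  then have "risk L \<eta> ?z \<le> risk L \<eta> q"
    using False a by (simp add: ereal_mult_le_mult_iff)
  then show ?thesis by (simp add: regret_def ereal_minus_mono)
qed simp

end

subsection \<open>The norm and the cost matrix\<close>

lemma finite_norm_inf2_set: "finite {\<bar>b $ j\<bar> + \<bar>b $ k\<bar> | j k :: 'm. j \<noteq> k}"
  for b :: "real ^ 'm"
  by (rule finite_subset[of _ "range (\<lambda>(j, k). \<bar>b $ j\<bar> + \<bar>b $ k\<bar>)"]) auto

lemma norm_inf2_ge: "j \<noteq> k \<Longrightarrow> \<bar>b $ j\<bar> + \<bar>b $ k\<bar> \<le> norm_inf2 b"
  unfolding norm_inf2_def by (rule Max_ge[OF finite_norm_inf2_set]) auto

text \<open>The distinct indices \<open>i\<close>, \<open>i'\<close> make the set under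
  \<open>Max\<close> nonempty.\<close>

lemma norm_inf2_scaleR:
  fixes b :: "real ^ 'm"
  assumes "0 \<le> a" "(i::'m) \<noteq> i'"
  shows "norm_inf2 (a *\<^sub>R b) = a * norm_inf2 b"
proof -
  let ?S = "{\<bar>b $ j\<bar> + \<bar>b $ k\<bar> | j k. j \<noteq> k}"
  have "\<bar>(a *\<^sub>R b) $ j\<bar> + \<bar>(a *\<^sub>R b) $ k\<bar> = a * (\<bar>b $ j\<bar> + \<bar>b $ k\<bar>)" for j k
    using assms(1) by (simp add: abs_mult distrib_left)
  then have "{\<bar>(a *\<^sub>R b) $ j\<bar> + \<bar>(a *\<^sub>R b) $ k\<bar> | j k. j \<noteq> k} = (*) a ` ?S"
    by auto
  moreover have "a * Max ?S = Max ((*) a ` ?S)"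
  proof (rule mono_Max_commute[OF _ finite_norm_inf2_set])
    show "mono ((*) a)" using assms(1) by (simp add: mono_def mult_left_mono)
    show "?S \<noteq> {}" using assms(2) by auto
  qed
  ultimately show ?thesis by (simp only: norm_inf2_def)
qed

lemma norm_inf2_zero:
  assumes "(i::'m) \<noteq> i'"
  shows "norm_inf2 (0 :: real ^ 'm) = 0"
  using norm_inf2_scaleR[of 0 i i' 0] assms by simp

lemma cost_bar_nonneg: "0 \<le> cost_bar C $ j $ k"
  by (simp add: cost_bar_def row_max_def)

text \<open>Makes component \<open>j\<close> of the score maximal at the vertex
  \<open>axis j 1\<close>, so that segments between vertices can be balanced.\<close>

lemma cost_bar_le_diag:
  assumes "cost_matrix C"
  shows "cost_bar C $ j $ k \<le> cost_bar C $ j $ j"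
  using assms by (simp add: cost_bar_def cost_matrix_def)

lemma score_nonneg:
  assumes "q \<in> prob_simplex"
  shows "0 \<le> (transpose (cost_bar C) *v q) $ k"
  using assms cost_bar_nonneg[of C]
  by (auto simp: matrix_vector_mult_def transpose_def prob_simplex_def intro!: sum_nonneg)

lemma score_axis: "(transpose A *v axis i 1) $ k = A $ i $ k"
  for A :: "real ^ 'm ^ 'm"
  by (simp add: matrix_vector_mult_basis column_def transpose_def)

text \<open>The \<open>row_max\<close> contribution is the same for every column and
  cancels.\<close>

lemma score_diff:
  "(transpose (cost_bar C) *v \<eta>) $ k - (transpose (cost_bar C) *v \<eta>) $ s
    = \<eta> \<bullet> column s C - \<eta> \<bullet> column k C"
  by (simp add: matrix_vector_mult_def transpose_def cost_bar_def inner_vec_def column_def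
      algebra_simps sum_subtractf)

lemma balance_iff:
  fixes A :: "real ^ 'm ^ 'm"
  shows "Max (range (\<lambda>j. column j A \<bullet> q)) \<le> (vec 1 \<bullet> (transpose A *v q)) / 2
    \<longleftrightarrow> (\<forall>j. (transpose A *v q) $ j \<le> (\<Sum>i\<in>UNIV. (transpose A *v q) $ i) / 2)"
proof -
  have "column j A \<bullet> q = (transpose A *v q) $ j" for j
    by (simp add: matrix_vector_mult_def transpose_def inner_vec_def column_def)
  moreover have "vec 1 \<bullet> x = (\<Sum>i\<in>UNIV. x $ i)" for x :: "real ^ 'm"
    by (simp add: inner_vec_def)
  ultimately show ?thesis by (subst Max_le_iff) (simp_all del: transpose_matrix_vector)
qed

lemma sum_ge_two:
  fixes f :: "'m::finite \<Rightarrow> real"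
  assumes "\<And>i. 0 \<le> f i" "j \<noteq> k"
  shows "f j + f k \<le> sum f UNIV"
  using sum_mono2[of UNIV "{j, k}" f] assms by simp

lemma exists_balanced_point:
  fixes A :: "real ^ 'm ^ 'm"
  assumes nonneg: "\<And>x j. x \<in> prob_simplex \<Longrightarrow> 0 \<le> (transpose A *v x) $ j"
    and q: "q \<in> prob_simplex" and \<eta>: "\<eta> \<in> prob_simplex"
    and s: "\<And>j. (transpose A *v q) $ j \<le> (transpose A *v q) $ s"
    and k: "k \<noteq> s" "(transpose A *v \<eta>) $ s \<le> (transpose A *v \<eta>) $ k"
  obtains a where "0 \<le> a" "a \<le> 1"
    "\<And>j. (transpose A *v ((1 - a) *\<^sub>R q + a *\<^sub>R \<eta>)) $ j
        \<le> (transpose A *v ((1 - a) *\<^sub>R q + a *\<^sub>R \<eta>)) $ s"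
    "(transpose A *v ((1 - a) *\<^sub>R q + a *\<^sub>R \<eta>)) $ s
        \<le> (\<Sum>i\<in>UNIV. (transpose A *v ((1 - a) *\<^sub>R q + a *\<^sub>R \<eta>)) $ i) / 2"
proof -
  define v where "v x = transpose A *v x" for x
  define g where "g x = v x $ s - (\<Sum>i\<in>UNIV. v x $ i) / 2" for x
  show ?thesis
  proof (cases "g q \<le> 0")
    case True
    then show ?thesis using that[of 0] s by (simp add: g_def v_def)
  next
    case False
    \<comment> \<open>At \<open>\<eta>\<close>, component \<open>s\<close> is at most component
      \<open>k\<close>, hence at most half of their sum.\<close>
    have "v \<eta> $ s + v \<eta> $ k \<le> (\<Sum>i\<in>UNIV. v \<eta> $ i)"
      using nonneg[OF \<eta>] k(1) by (intro sum_ge_two) (auto simp: v_def)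
    then have g\<eta>: "g \<eta> \<le> 0" using k(2) by (simp add: g_def v_def)
    \<comment> \<open>\<open>g\<close> is affine on the segment; this is its root.\<close>
    define a where "a = g q / (g q - g \<eta>)"
    have a: "0 \<le> a" "a \<le> 1" using False g\<eta> by (auto simp: a_def field_simps)
    let ?z = "(1 - a) *\<^sub>R q + a *\<^sub>R \<eta>"
    have z: "?z \<in> prob_simplex" by (rule prob_simplex_segment[OF q \<eta> a])
    have "v ?z = (1 - a) *\<^sub>R v q + a *\<^sub>R v \<eta>"
      by (simp add: v_def matrix_vector_right_distrib scaleR_matrix_vector_assoc matrix_vector_mult_scaleR)
    then have vz: "v ?z $ j = (1 - a) * v q $ j + a * v \<eta> $ j" for j by simp
    have "g ?z = (1 - a) * g q + a * g \<eta>"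
      unfolding g_def vz sum.distrib sum_distrib_left[symmetric] by (simp add: field_simps)
    also have "\<dots> = 0" using False g\<eta> by (simp add: a_def field_simps)
    finally have g0: "g ?z = 0" .
    have "v ?z $ j \<le> v ?z $ s" for j
    proof (cases "j = s")
      case False
      \<comment> \<open>Component \<open>s\<close> is exactly half of the total, so the other
        nonnegative components share the other half.\<close>
      then have "v ?z $ j + v ?z $ s \<le> (\<Sum>i\<in>UNIV. v ?z $ i)"
        using nonneg[OF z] by (intro sum_ge_two) (auto simp: v_def)
      then show ?thesis using g0 by (simp add: g_def)
    qed simp
    then show ?thesis using that[OF a] g0 by (simp add: g_def v_def)
  qed
qed

lemma psi_lower_le:
  assumes "\<eta> \<in> prob_simplex" "q \<in> prob_simplex"
    and "norm_inf2 (transpose (cost_bar C) *v (\<eta> - q)) = t"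
    and "\<And>j. (transpose (cost_bar C) *v q) $ j \<le> (\<Sum>i\<in>UNIV. (transpose (cost_bar C) *v q) $ i) / 2"
  shows "psi_lower L C t \<le> regret L \<eta> q"
  unfolding psi_lower_def
  by (rule INF_lower2[of "(\<eta>, q)"])
    (use assms in \<open>simp_all only: balance_iff mem_Collect_eq prod.case simp_thms order_refl\<close>)

theorem corollary3:
  fixes C :: "real ^ 'm ^ 'm"
    and L :: "'m \<Rightarrow> real ^ 'm \<Rightarrow> ereal"
    and sel :: "real ^ 'm \<Rightarrow> 'm"
  assumes "CARD('m) \<ge> 2"
    and "cost_matrix C"
    and "proper_scoring_rule L"
    and "argmax_rule sel"
  shows "\<forall>\<eta>\<in>prob_simplex. \<forall>q\<in>prob_simplex.
    psi_lower L C (regret_cw sel C \<eta> (transpose (cost_bar C) *v q)) \<le> regret L \<eta> q"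
proof (intro ballI)
  fix \<eta> q :: "real ^ 'm"
  assume \<eta>: "\<eta> \<in> prob_simplex" and q: "q \<in> prob_simplex"
  define v where "v x = transpose (cost_bar C) *v x" for x
  define s where "s = sel (v q)"
  define t where "t = regret_cw sel C \<eta> (v q)"
  obtain i i' :: 'm where ii': "i \<noteq> i'"
    using assms(1) card_le_Suc0_iff_eq[of "UNIV :: 'm set"] by auto
  have s: "v q $ j \<le> v q $ s" for j
    using assms(4) by (auto simp: argmax_rule_def s_def is_arg_max_linorder)
  have "Min (range (\<lambda>k. \<eta> \<bullet> column k C)) \<in> range (\<lambda>k. \<eta> \<bullet> column k C)"
    by (intro Min_in) auto
  then obtain k where k: "Min (range (\<lambda>k. \<eta> \<bullet> column k C)) = \<eta> \<bullet> column k C" by blast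
  have t: "t = v \<eta> $ k - v \<eta> $ s"
    using k unfolding v_def score_diff
    by (simp add: t_def regret_cw_def loss_cw_def s_def v_def inner_vec_def column_def)
  have "\<eta> \<bullet> column k C \<le> \<eta> \<bullet> column s C"
    unfolding k[symmetric] by (intro Min_le) auto
  then have t0: "0 \<le> t" using score_diff[of C \<eta> k s] by (simp add: t v_def)
  have "psi_lower L C t \<le> regret L \<eta> q"
  proof (cases "t = 0")
    case True
    \<comment> \<open>Possibly \<open>k = s\<close>, and then the segment from \<open>q\<close> to
      \<open>\<eta>\<close> may contain no balanced point. Any balanced point, used as both outcome
      and action, has norm and regret zero; one lies between two vertices.\<close>
    have ax: "v (axis j 1) $ l \<le> v (axis j 1) $ j" for j l
      using cost_bar_le_diag[OF assms(2)] by (simp add: v_def score_axis del: transpose_matrix_vector)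
    obtain a where a: "0 \<le> a" "a \<le> 1"
      and "\<And>j. v ((1 - a) *\<^sub>R axis i 1 + a *\<^sub>R axis i' 1) $ j
        \<le> v ((1 - a) *\<^sub>R axis i 1 + a *\<^sub>R axis i' 1) $ i"
        "v ((1 - a) *\<^sub>R axis i 1 + a *\<^sub>R axis i' 1) $ i
        \<le> (\<Sum>l\<in>UNIV. v ((1 - a) *\<^sub>R axis i 1 + a *\<^sub>R axis i' 1) $ l) / 2"
      using exists_balanced_point[OF score_nonneg axis_in_prob_simplex axis_in_prob_simplex
          ax[unfolded v_def] ii'[symmetric] ax[unfolded v_def]]
      unfolding v_def by metis
    then have bal: "v ((1 - a) *\<^sub>R axis i 1 + a *\<^sub>R axis i' 1) $ j
        \<le> (\<Sum>l\<in>UNIV. v ((1 - a) *\<^sub>R axis i 1 + a *\<^sub>R axis i' 1) $ l) / 2" for j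
      by (meson order_trans)
    let ?z = "(1 - a) *\<^sub>R axis i 1 + a *\<^sub>R axis i' 1 :: real ^ 'm"
    have z: "?z \<in> prob_simplex"
      by (intro prob_simplex_segment axis_in_prob_simplex a)
    have "psi_lower L C t \<le> regret L ?z ?z"
      using bal by (intro psi_lower_le[OF z z]) (auto simp: True v_def norm_inf2_zero[OF ii'])
    also have "\<dots> \<le> regret L \<eta> q"
      by (simp add: regret_self[OF assms(3) z] regret_nonneg[OF assms(3) \<eta> q])
    finally show ?thesis .
  next
    case False
    then have ks: "k \<noteq> s" "v \<eta> $ s \<le> v \<eta> $ k" using t t0 by auto
    obtain a where a: "0 \<le> a" "a \<le> 1"
      and max_s: "\<And>j. v ((1 - a) *\<^sub>R q + a *\<^sub>R \<eta>) $ j \<le> v ((1 - a) *\<^sub>R q + a *\<^sub>R \<eta>) $ s"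
      and half: "v ((1 - a) *\<^sub>R q + a *\<^sub>R \<eta>) $ s
        \<le> (\<Sum>l\<in>UNIV. v ((1 - a) *\<^sub>R q + a *\<^sub>R \<eta>) $ l) / 2"
      using exists_balanced_point[OF score_nonneg q \<eta> s[unfolded v_def] ks[unfolded v_def]]
      unfolding v_def by metis
    define q' where "q' = (1 - a) *\<^sub>R q + a *\<^sub>R \<eta>"
    have q': "q' \<in> prob_simplex"
      unfolding q'_def by (rule prob_simplex_segment[OF q \<eta> a])
    have bal: "v q' $ j \<le> (\<Sum>l\<in>UNIV. v q' $ l) / 2" for j
      using max_s half unfolding q'_def by (meson order_trans)
    define n where "n = norm_inf2 (v (\<eta> - q'))"
    have "v (\<eta> - q') = v \<eta> - v q'" by (simp add: v_def matrix_vector_mult_diff_distrib)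
    \<comment> \<open>Since \<open>v q' $ k\<close> \<le> \<open>v q' $ s\<close>, subtracting
      \<open>v q'\<close> from \<open>v \<eta>\<close> does not decrease the gap between components
      \<open>k\<close> and \<open>s\<close>.\<close>
    then have "t \<le> \<bar>v (\<eta> - q') $ k\<bar> + \<bar>v (\<eta> - q') $ s\<bar>"
      using max_s[of k] by (simp add: t q'_def)
    also have "\<dots> \<le> n" unfolding n_def by (rule norm_inf2_ge[OF ks(1)])
    finally have tn: "t \<le> n" .
    \<comment> \<open>The norm is homogeneous along the segment from \<open>q'\<close> to
      \<open>\<eta>\<close>, so this fraction brings it from \<open>n\<close> down to exactly
      \<open>t\<close>.\<close>
    define b where "b = t / n"
    have b: "0 \<le> b" "b \<le> 1" using tn t0 False by (auto simp: b_def)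
    let ?\<eta>' = "(1 - b) *\<^sub>R q' + b *\<^sub>R \<eta>"
    have \<eta>': "?\<eta>' \<in> prob_simplex" by (rule prob_simplex_segment[OF q' \<eta> b])
    have "v (?\<eta>' - q') = b *\<^sub>R v (\<eta> - q')"
      by (simp add: v_def matrix_vector_mult_scaleR[symmetric] algebra_simps)
    then have "norm_inf2 (v (?\<eta>' - q')) = t"
      using norm_inf2_scaleR[OF b(1) ii'] tn t0 False by (simp add: b_def flip: n_def)
    then have "psi_lower L C t \<le> regret L ?\<eta>' q'"
      using bal by (intro psi_lower_le[OF \<eta>' q']) (auto simp: v_def)
    also have "\<dots> \<le> regret L \<eta> q'" by (rule regret_shrink_outcome[OF assms(3) \<eta> q' b])
    also have "\<dots> \<le> regret L \<eta> q"
      unfolding q'_def by (rule regret_shrink_action[OF assms(3) \<eta> q a])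
    finally show ?thesis .
  qed
  then show "psi_lower L C (regret_cw sel C \<eta> (transpose (cost_bar C) *v q)) \<le> regret L \<eta> q"
    by (simp add: t_def v_def)
qed

end
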